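(* Let $S\subset Ent(\mathbb{C})$ be a nearly abelian semigroup with commutator set $K(S)$, and let $G(S)$ be the group generated by $K(S)$. Then the semigroup $T(S)=\langle G(S),S\rangle$ generated by $S$ and $G(S)$ is right amenable.
   Context: $Ent(\mathbb{C})$ is the semigroup of entire maps of $\mathbb{C}$ under composition, and $\mathrm{Aff}(\mathbb{C})$ is the group of affine maps $z\mapsto az+b$, $a\neq0$. A semigroup $S$ of non-constant entire maps is called nearly abelian if for every pair $f,g\in S$ there exists $\gamma\in\mathrm{Aff}(\mathbb{C})$ such that $f\circ g=\gamma\circ g\circ f$. The collection $K(S)\subset\mathrm{Aff}(\mathbb{C})$ of all such $\gamma$, over all pairs $f,g\in S$, is the commutator set of $S$. A semigroup $T$ is right amenable if there is a finitely additive probability measure $\mu$ defined on all subsets of $T$ with $\mu(r_\gamma^{-1}(A))=\mu(A)$ for all $A\subset T$, $\gamma\in T$, where $r_\gamma(g)=g\gamma$. *)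

theory Defs
  imports "HOL-Analysis.Analysis" "HOL-Algebra.Generated_Groups"
begin

definition Ent :: "(complex \<Rightarrow> complex) set" where
  "Ent = {f. f holomorphic_on UNIV}"

definition Aff :: "(complex \<Rightarrow> complex) set" where
  "Aff = {\<gamma>. \<exists>a b. a \<noteq> 0 \<and> \<gamma> = (\<lambda>z. a * z + b)}"

definition Aff_group :: "(complex \<Rightarrow> complex) monoid" where
  "Aff_group = \<lparr>carrier = Aff, mult = (\<circ>), one = id\<rparr>"

lemma AffI: "a \<noteq> 0 \<Longrightarrow> (\<lambda>z. a * z + b) \<in> Aff"
  by (auto simp: Aff_def)

lemma group_Aff_group: "group Aff_group"
proof (rule groupI)
  fix x y assume "x \<in> carrier Aff_group" "y \<in> carrier Aff_group"
  then obtain a b c d where h: "a \<noteq> 0" "c \<noteq> 0"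
      "x = (\<lambda>z. a * z + b)" "y = (\<lambda>z. c * z + d)"
    by (auto simp: Aff_group_def Aff_def)
  then have "x \<circ> y = (\<lambda>z. (a * c) * z + (a * d + b))" "a * c \<noteq> 0"
    by (auto simp: fun_eq_iff algebra_simps)
  then show "x \<otimes>\<^bsub>Aff_group\<^esub> y \<in> carrier Aff_group"
    using AffI by (simp add: Aff_group_def)
next
  have "id = (\<lambda>z::complex. 1 * z + 0)" by (simp add: fun_eq_iff)
  then show "\<one>\<^bsub>Aff_group\<^esub> \<in> carrier Aff_group"
    using AffI[of 1 0] by (simp add: Aff_group_def)
next
  fix x assume "x \<in> carrier Aff_group"
  then obtain a b where h: "a \<noteq> 0" "x = (\<lambda>z. a * z + b)"
    by (auto simp: Aff_group_def Aff_def)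
  define y where "y = (\<lambda>z. (1 / a) * z + (- b / a))"
  have "y \<in> Aff" unfolding y_def using h by (intro AffI) auto
  moreover have "y \<circ> x = id"
    using h by (simp add: y_def fun_eq_iff field_simps)
  ultimately show "\<exists>y\<in>carrier Aff_group. y \<otimes>\<^bsub>Aff_group\<^esub> x = \<one>\<^bsub>Aff_group\<^esub>"
    unfolding Aff_group_def by auto
qed (auto simp: Aff_group_def comp_assoc)

definition comp_closed :: "('a \<Rightarrow> 'a) set \<Rightarrow> bool" where
  "comp_closed S \<longleftrightarrow> (\<forall>f\<in>S. \<forall>g\<in>S. f \<circ> g \<in> S)"

definition nearly_abelian :: "(complex \<Rightarrow> complex) set \<Rightarrow> bool" where
  "nearly_abelian S \<longleftrightarrow>
     S \<subseteq> Ent \<and> (\<forall>f\<in>S. \<not> f constant_on UNIV) \<and> comp_closed S \<and>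
     (\<forall>f\<in>S. \<forall>g\<in>S. \<exists>\<gamma>\<in>Aff. f \<circ> g = \<gamma> \<circ> g \<circ> f)"

definition commutator_set :: "(complex \<Rightarrow> complex) set \<Rightarrow> (complex \<Rightarrow> complex) set" where
  "commutator_set S = {\<gamma> \<in> Aff. \<exists>f\<in>S. \<exists>g\<in>S. f \<circ> g = \<gamma> \<circ> g \<circ> f}"

definition commutator_group :: "(complex \<Rightarrow> complex) set \<Rightarrow> (complex \<Rightarrow> complex) set" where
  "commutator_group S = generate Aff_group (commutator_set S)"

inductive_set comp_semigroup_generated :: "('a \<Rightarrow> 'a) set \<Rightarrow> ('a \<Rightarrow> 'a) set"
  for X :: "('a \<Rightarrow> 'a) set" where
  base: "f \<in> X \<Longrightarrow> f \<in> comp_semigroup_generated X"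
| comp: "f \<in> comp_semigroup_generated X \<Longrightarrow> g \<in> comp_semigroup_generated X
         \<Longrightarrow> f \<circ> g \<in> comp_semigroup_generated X"

definition extended_semigroup :: "(complex \<Rightarrow> complex) set \<Rightarrow> (complex \<Rightarrow> complex) set" where
  "extended_semigroup S = comp_semigroup_generated (commutator_group S \<union> S)"

(* The values of \<mu> outside Pow T are irrelevant. *)
definition right_amenable :: "('a \<Rightarrow> 'a \<Rightarrow> 'a) \<Rightarrow> 'a set \<Rightarrow> bool" where
  "right_amenable op T \<longleftrightarrow>
     (\<exists>\<mu> :: 'a set \<Rightarrow> real.
        (\<forall>A. A \<subseteq> T \<longrightarrow> 0 \<le> \<mu> A) \<and> \<mu> T = 1 \<and>
        (\<forall>A B. A \<subseteq> T \<longrightarrow> B \<subseteq> T \<longrightarrow> A \<inter> B = {} \<longrightarrow> \<mu> (A \<union> B) = \<mu> A + \<mu> B) \<and>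
        (\<forall>A \<gamma>. A \<subseteq> T \<longrightarrow> \<gamma> \<in> T \<longrightarrow> \<mu> {g \<in> T. op g \<gamma> \<in> A} = \<mu> A))"

end

theory Submission
  imports Defs "HOL-Complex_Analysis.Conformal_Mappings"
begin

text \<open>
  Write \<open>G\<close> for the group generated by the commutator set and \<open>T\<close> for the semigroup generated by
  \<open>S\<close> and \<open>G\<close>. The semigroup \<open>T\<close> is amenable because it is ``soluble'': it carries a chain
  \<open>{id} \<subseteq> V \<subseteq> G \<subseteq> T\<close>, where \<open>V\<close> is the set of translations in \<open>G\<close>, such that for consecutive
  members \<open>N \<subseteq> H\<close> one has \<open>t N \<subseteq> N t\<close> and \<open>s t \<in> N t s\<close> for all \<open>s, t \<in> H\<close>.

  One extension step, lemma \<open>right_invariant_mean_extension\<close>, is applied three times. It takes a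
  right-invariant mean \<open>m\<close> on such an \<open>N\<close> and
  produces one on \<open>H\<close>. Averaging a bounded function \<open>f\<close> on \<open>H\<close> with \<open>m\<close> along the orbits \<open>N t\<close>
  yields a function constant on these orbits; this turns right translations of \<open>f\<close> into right
  translations of its average. On functions constant on orbits, right translations commute with
  each other, so the Markov-Kakutani argument (lemma \<open>invariant_mean_exists\<close>) gives a mean \<open>\<nu>\<close>
  invariant under all of them, and \<open>f \<mapsto> \<nu> (average of f)\<close> is the mean that is sought. The averaging
  integrates functions, which is why means are functionals here; a measure is recovered at the
  end by evaluating on indicator functions.

  For \<open>{id} \<subseteq> V \<subseteq> G\<close> the hypotheses hold since the affine group is metabelian. For \<open>G \<subseteq> T\<close> the point
  is that \<open>g \<gamma> \<in> G g\<close> for \<open>g \<in> S\<close> and \<open>\<gamma> \<in> G\<close>. If \<open>f h = \<gamma> h f\<close>, then writing \<open>f g h\<close> in two ways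
  gives \<open>\<alpha> g h f = f g h = \<beta> g f h = \<beta> g \<gamma> h f\<close> with \<open>\<alpha>, \<beta> \<in> G\<close>, and the non-constant entire map \<open>h f\<close>
  can be cancelled on the right.
\<close>

section \<open>Means on bounded functions\<close>

text \<open>A mean is a functional on all functions, but only its values on functions bounded on \<open>X\<close>
  are constrained. Keeping the functional total makes the set of means a subset of a product of
  copies of the real line.\<close>

definition mean_on :: "'a set \<Rightarrow> (('a \<Rightarrow> real) \<Rightarrow> real) \<Rightarrow> bool" where
  "mean_on X M \<longleftrightarrow>
     (\<forall>f g. bounded (f ` X) \<longrightarrow> bounded (g ` X) \<longrightarrow> M (\<lambda>x. f x + g x) = M f + M g) \<and>
     (\<forall>c f. bounded (f ` X) \<longrightarrow> M (\<lambda>x. c * f x) = c * M f) \<and>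
     (\<forall>f. bounded (f ` X) \<longrightarrow> (\<forall>x\<in>X. 0 \<le> f x) \<longrightarrow> 0 \<le> M f) \<and>
     M (\<lambda>x. 1) = 1"

lemma mean_onD:
  assumes "mean_on X M"
  shows mean_add: "bounded (f ` X) \<Longrightarrow> bounded (g ` X) \<Longrightarrow> M (\<lambda>x. f x + g x) = M f + M g"
    and mean_scale: "bounded (f ` X) \<Longrightarrow> M (\<lambda>x. c * f x) = c * M f"
    and mean_nonneg: "bounded (f ` X) \<Longrightarrow> (\<And>x. x \<in> X \<Longrightarrow> 0 \<le> f x) \<Longrightarrow> 0 \<le> M f"
    and mean_one: "M (\<lambda>x. 1) = 1"
  using assms unfolding mean_on_def by blast+

lemma bounded_scale_image:
  fixes f :: "'a \<Rightarrow> real"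
  shows "bounded (f ` X) \<Longrightarrow> bounded ((\<lambda>x. c * f x) ` X)"
  using bounded_scaling[of "f ` X" c] by (simp add: image_image)

lemma bounded_image_of_bound:
  fixes f :: "'a \<Rightarrow> real"
  shows "(\<And>x. x \<in> X \<Longrightarrow> \<bar>f x\<bar> \<le> c) \<Longrightarrow> bounded (f ` X)"
  by (auto simp: bounded_iff)

lemma bounded_image_comp:
  assumes "bounded (f ` X)" "r \<in> Y \<rightarrow> X"
  shows "bounded ((f \<circ> r) ` Y)"
  using assms by (auto intro: bounded_subset)

lemma mean_mono:
  assumes M: "mean_on X M" and f: "bounded (f ` X)" and g: "bounded (g ` X)"
    and le: "\<And>x. x \<in> X \<Longrightarrow> f x \<le> g x"
  shows "M f \<le> M g"
proof -
  have b: "bounded ((\<lambda>x. g x + (- 1) * f x) ` X)"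
    by (intro bounded_plus_comp bounded_scale_image f g)
  have "0 \<le> M (\<lambda>x. g x + (- 1) * f x)"
    by (rule mean_nonneg[OF M b]) (use le in auto)
  also have "\<dots> = M g + (- 1) * M f"
    using mean_add[OF M g bounded_scale_image[OF f, of "- 1"]] mean_scale[OF M f, of "- 1"]
    by simp
  finally show ?thesis by simp
qed

lemma mean_cong:
  assumes M: "mean_on X M" and f: "bounded (f ` X)" and eq: "\<And>x. x \<in> X \<Longrightarrow> f x = g x"
  shows "M f = M g"
proof -
  have g: "bounded (g ` X)"
    using f eq by (metis image_cong)
  show ?thesis
    by (rule antisym) (auto intro!: mean_mono[OF M] f g simp: eq)
qed

lemma mean_abs_le:
  assumes M: "mean_on X M" and le: "\<And>x. x \<in> X \<Longrightarrow> \<bar>f x\<bar> \<le> c"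
  shows "\<bar>M f\<bar> \<le> c"
proof -
  have f: "bounded (f ` X)" by (rule bounded_image_of_bound[OF le])
  have k: "bounded ((\<lambda>x. k) ` X)" for k :: real by (rule bounded_image_of_bound[of _ _ "\<bar>k\<bar>"]) simp
  have const: "M (\<lambda>x. k) = k" for k
    using mean_scale[OF M k, of k 1] mean_one[OF M] by simp
  have "M f \<le> M (\<lambda>x. c)" "M (\<lambda>x. - c) \<le> M f"
    using le by (auto intro!: mean_mono[OF M] f k simp: abs_le_iff minus_le_iff)
  then show ?thesis by (simp add: const abs_le_iff)
qed

lemma funpow_maps: "s \<in> X \<rightarrow> X \<Longrightarrow> s ^^ i \<in> X \<rightarrow> X"
  by (induction i) auto

section \<open>The Markov-Kakutani argument\<close>
lemma mean_average:
  assumes M: "mean_on X M" and s: "s \<in> X \<rightarrow> X" and n: "0 < n"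
  shows "mean_on X (\<lambda>f. (\<Sum>i<n. M (f \<circ> s ^^ i)) / real n)"
proof -
  have b: "bounded ((f \<circ> s ^^ i) ` X)" if "bounded (f ` X)" for f :: "'a \<Rightarrow> real" and i
    by (rule bounded_image_comp[OF that funpow_maps[OF s]])
  have "M ((\<lambda>x. f x + g x) \<circ> s ^^ i) = M (f \<circ> s ^^ i) + M (g \<circ> s ^^ i)"
    if "bounded (f ` X)" "bounded (g ` X)" for f g i
    using mean_add[OF M b[OF that(1)] b[OF that(2)]] by (simp add: o_def)
  moreover have "M ((\<lambda>x. c * f x) \<circ> s ^^ i) = c * M (f \<circ> s ^^ i)"
    if "bounded (f ` X)" for c f i
    using mean_scale[OF M b[OF that]] by (simp add: o_def)
  moreover have "0 \<le> M (f \<circ> s ^^ i)" if "bounded (f ` X)" "\<forall>x\<in>X. 0 \<le> f x" for f i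
    by (rule mean_nonneg[OF M b[OF that(1)]]) (use that funpow_maps[OF s, of i] in auto)
  ultimately show ?thesis
    using n unfolding mean_on_def
    by (auto simp: sum.distrib add_divide_distrib sum_distrib_left mean_one[OF M] o_def
        intro!: divide_nonneg_nonneg sum_nonneg)
qed

text \<open>The maps need to commute only as seen by the functions in \<open>L\<close>; closure of \<open>L\<close> under
  composition is what makes this weak commutation pass to iterates.\<close>
lemma comm_funpow:
  assumes s: "s \<in> X \<rightarrow> X" and r: "r \<in> X \<rightarrow> X"
    and closed: "\<And>\<phi>. \<phi> \<in> L \<Longrightarrow> \<phi> \<circ> s \<in> L"
    and comm: "\<And>\<phi> x. \<phi> \<in> L \<Longrightarrow> x \<in> X \<Longrightarrow> \<phi> (r (s x)) = \<phi> (s (r x))"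
    and "\<phi> \<in> L" "x \<in> X"
  shows "\<phi> (r ((s ^^ i) x)) = \<phi> ((s ^^ i) (r x))"
  using \<open>\<phi> \<in> L\<close>
proof (induction i arbitrary: \<phi>)
  case (Suc i)
  have "\<phi> (r ((s ^^ Suc i) x)) = (\<phi> \<circ> s) (r ((s ^^ i) x))"
    using comm[OF Suc.prems, of "(s ^^ i) x"] funpow_maps[OF s, of i] \<open>x \<in> X\<close> by auto
  also have "\<dots> = (\<phi> \<circ> s) ((s ^^ i) (r x))"
    by (rule Suc.IH[OF closed[OF Suc.prems]])
  finally show ?case by simp
qed simp

text \<open>Start from a point evaluation and average successively over the first \<open>n\<close> iterates of each
  map in \<open>F\<close>. Averaging over a new map \<open>s\<close> makes the mean invariant under \<open>s\<close> up to \<open>2 c / n\<close> by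
  telescoping, and keeps the estimate for the old maps, because these commute with the iterates
  of \<open>s\<close> and the estimate is uniform over the functions with the same bound \<open>c\<close>.\<close>
lemma almost_invariant_mean:
  assumes "finite F" and "X \<noteq> {}" and n: "0 < n"
    and "\<And>r. r \<in> F \<Longrightarrow> r \<in> X \<rightarrow> X"
    and "\<And>\<phi> r. \<phi> \<in> L \<Longrightarrow> r \<in> F \<Longrightarrow> \<phi> \<circ> r \<in> L"
    and "\<And>\<phi> r s x. \<phi> \<in> L \<Longrightarrow> r \<in> F \<Longrightarrow> s \<in> F \<Longrightarrow> x \<in> X \<Longrightarrow> \<phi> (r (s x)) = \<phi> (s (r x))"
  shows "\<exists>M. mean_on X M \<and>
    (\<forall>\<phi>\<in>L. \<forall>r\<in>F. \<forall>c. (\<forall>x\<in>X. \<bar>\<phi> x\<bar> \<le> c) \<longrightarrow> \<bar>M (\<phi> \<circ> r) - M \<phi>\<bar> \<le> 2 * c / real n)"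
  using assms(1,4-)
proof (induction F rule: finite_induct)
  case empty
  obtain x where "x \<in> X" using \<open>X \<noteq> {}\<close> by blast
  then have "mean_on X (\<lambda>f. f x)" by (auto simp: mean_on_def)
  then show ?case by blast
next
  case (insert s F)
  note maps = insert.prems(1) and closed = insert.prems(2) and comm = insert.prems(3)
  obtain M where M: "mean_on X M" and inv: "\<And>\<phi> r c. \<phi> \<in> L \<Longrightarrow> r \<in> F \<Longrightarrow>
      (\<And>x. x \<in> X \<Longrightarrow> \<bar>\<phi> x\<bar> \<le> c) \<Longrightarrow> \<bar>M (\<phi> \<circ> r) - M \<phi>\<bar> \<le> 2 * c / real n"
  proof -
    have "\<exists>M. mean_on X M \<and>
      (\<forall>\<phi>\<in>L. \<forall>r\<in>F. \<forall>c. (\<forall>x\<in>X. \<bar>\<phi> x\<bar> \<le> c) \<longrightarrow> \<bar>M (\<phi> \<circ> r) - M \<phi>\<bar> \<le> 2 * c / real n)"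
      by (intro insert.IH maps closed comm insertI2)
    then show ?thesis using that by blast
  qed
  have s: "s \<in> X \<rightarrow> X" using maps by blast
  have closed_pow: "\<phi> \<circ> s ^^ i \<in> L" if "\<phi> \<in> L" for \<phi> i
    using that
  proof (induction i)
    case (Suc i)
    then show ?case
      using closed[of "\<phi> \<circ> s ^^ i" s] by (simp add: funpow_Suc_right comp_assoc del: funpow.simps(2))
  qed simp
  define M' where "M' = (\<lambda>f. (\<Sum>i<n. M (f \<circ> s ^^ i)) / real n)"
  have "\<bar>M' (\<phi> \<circ> r) - M' \<phi>\<bar> \<le> 2 * c / real n"
    if \<phi>: "\<phi> \<in> L" and r: "r \<in> insert s F" and c: "\<And>x. x \<in> X \<Longrightarrow> \<bar>\<phi> x\<bar> \<le> c" for \<phi> r c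
  proof (cases "r = s")
    case True
    have bound: "\<bar>M (\<phi> \<circ> s ^^ i)\<bar> \<le> c" for i
      by (rule mean_abs_le[OF M]) (use c funpow_maps[OF s, of i] in auto)
    have "M' (\<phi> \<circ> s) - M' \<phi> = (\<Sum>i<n. M (\<phi> \<circ> s ^^ Suc i) - M (\<phi> \<circ> s ^^ i)) / real n"
      by (simp add: M'_def sum_subtractf diff_divide_distrib comp_assoc)
    also have "\<dots> = (M (\<phi> \<circ> s ^^ n) - M (\<phi> \<circ> s ^^ 0)) / real n"
      by (subst sum_lessThan_telescope) simp
    finally show ?thesis
      using n True bound[of n] bound[of 0] by (simp add: divide_right_mono)
  next
    case False
    then have r: "r \<in> F" using r by blast
    have step: "\<bar>M ((\<phi> \<circ> r) \<circ> s ^^ i) - M (\<phi> \<circ> s ^^ i)\<bar> \<le> 2 * c / real n" for i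
    proof -
      have "M ((\<phi> \<circ> r) \<circ> s ^^ i) = M ((\<phi> \<circ> s ^^ i) \<circ> r)"
      proof (rule mean_cong[OF M])
        show "bounded ((\<phi> \<circ> r \<circ> s ^^ i) ` X)"
          using c maps[of r] r funpow_maps[OF s, of i]
          by (intro bounded_image_of_bound[of _ _ c]) auto
        show "(\<phi> \<circ> r \<circ> s ^^ i) x = (\<phi> \<circ> s ^^ i \<circ> r) x" if "x \<in> X" for x
          using comm_funpow[OF s _ _ _ \<phi> that, of r i] maps closed comm r by auto
      qed
      moreover have "\<bar>M ((\<phi> \<circ> s ^^ i) \<circ> r) - M (\<phi> \<circ> s ^^ i)\<bar> \<le> 2 * c / real n"
        by (rule inv[OF closed_pow[OF \<phi>] r]) (use c funpow_maps[OF s, of i] in auto)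
      ultimately show ?thesis by simp
    qed
    have "\<bar>M' (\<phi> \<circ> r) - M' \<phi>\<bar> = \<bar>\<Sum>i<n. M ((\<phi> \<circ> r) \<circ> s ^^ i) - M (\<phi> \<circ> s ^^ i)\<bar> / real n"
      by (simp add: M'_def sum_subtractf flip: diff_divide_distrib)
    also have "\<dots> \<le> (\<Sum>i<n. 2 * c / real n) / real n"
      by (intro divide_right_mono order_trans[OF sum_abs] sum_mono step) simp
    finally show ?thesis using n by simp
  qed
  moreover have "mean_on X M'"
    unfolding M'_def by (rule mean_average[OF M s n])
  ultimately show ?case by blast
qed

lemma compact_Pi_intervals:
  fixes B :: "'a \<Rightarrow> real"
  shows "compact {M. \<forall>f. M f \<in> {- B f..B f}}"
proof -
  have "compactin (product_topology (\<lambda>f. euclideanreal) UNIV) (PiE UNIV (\<lambda>f. {- B f..B f}))"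
    by (subst compactin_PiE) auto
  moreover have "PiE UNIV (\<lambda>f. {- B f..B f}) = {M. \<forall>f. M f \<in> {- B f..B f}}"
    by (auto simp: PiE_def Pi_def)
  ultimately show ?thesis
    by (simp add: euclidean_product_topology)
qed

text \<open>Invariance under one map up to \<open>2 c / n\<close> is a closed condition, and finitely many such
  conditions can be met together by the previous lemma. Tychonoff's theorem then provides a mean
  that meets them all.\<close>
lemma invariant_mean_exists:
  assumes X: "X \<noteq> {}"
    and maps: "\<And>r. r \<in> R \<Longrightarrow> r \<in> X \<rightarrow> X"
    and bdd: "\<And>\<phi>. \<phi> \<in> L \<Longrightarrow> bounded (\<phi> ` X)"
    and closed: "\<And>\<phi> r. \<phi> \<in> L \<Longrightarrow> r \<in> R \<Longrightarrow> \<phi> \<circ> r \<in> L"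
    and comm: "\<forall>\<phi>\<in>L. \<forall>r\<in>R. \<forall>s\<in>R. \<forall>x\<in>X. \<phi> (r (s x)) = \<phi> (s (r x))"
  shows "\<exists>M. mean_on X M \<and> (\<forall>\<phi>\<in>L. \<forall>r\<in>R. M (\<phi> \<circ> r) = M \<phi>)"
proof -
  define B where "B f = (if bounded (f ` X) then SUP x\<in>X. \<bar>f x\<bar> else 0)" for f :: "'a \<Rightarrow> real"
  define K where "K = {M. \<forall>f. M f \<in> {- B f..B f}}"
  define C where "C = (\<lambda>(r, n). {M. mean_on X M \<and>
      (\<forall>\<phi>\<in>L. \<forall>c. (\<forall>x\<in>X. \<bar>\<phi> x\<bar> \<le> c) \<longrightarrow> \<bar>M (\<phi> \<circ> r) - M \<phi>\<bar> \<le> 2 * c / real (n::nat))})"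
  have le_B: "\<bar>f x\<bar> \<le> B f" if "bounded (f ` X)" "x \<in> X" for f x
  proof -
    obtain c where "\<And>x. x \<in> X \<Longrightarrow> \<bar>f x\<bar> \<le> c"
      using \<open>bounded (f ` X)\<close> unfolding bounded_iff by auto
    then have "bdd_above ((\<lambda>x. \<bar>f x\<bar>) ` X)" by (auto intro!: bdd_aboveI)
    then show ?thesis using that by (auto simp: B_def intro!: cSUP_upper)
  qed
  have eval: "continuous_on UNIV (\<lambda>M :: ('a \<Rightarrow> real) \<Rightarrow> real. M f)" for f
    by simp
  have clo: "closed (C i)" for i
  proof -
    have "closed {M. mean_on X M}"
      unfolding mean_on_def
      by (intro closed_Collect_conj closed_Collect_all closed_Collect_imp closed_Collect_eq
          closed_Collect_le continuous_intros eval) auto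
    moreover have "closed {M. \<forall>\<phi>\<in>L. \<forall>c. (\<forall>x\<in>X. \<bar>\<phi> x\<bar> \<le> c) \<longrightarrow> 
         \<bar>M (\<phi> \<circ> r) - M \<phi>\<bar> \<le> 2 * c / real n}" for r n
      unfolding Ball_def
      by (intro closed_Collect_all closed_Collect_imp closed_Collect_le continuous_intros eval) auto
    ultimately show ?thesis
      unfolding C_def by (cases i) (auto intro: closed_Collect_conj)
  qed
  have "K \<inter> (\<Inter>i\<in>R \<times> {0::nat<..}. C i) \<noteq> {}"
  proof (rule compact_imp_fip_image)
    show "compact K" unfolding K_def by (rule compact_Pi_intervals)
    show "closed (C i)" for i by (rule clo)
    fix I assume I: "finite I" "I \<subseteq> R \<times> {0::nat<..}"
    define n where "n = Max (insert 1 (snd ` I))"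
    have n: "m \<le> n" if "(r, m) \<in> I" for r m
      using I that unfolding n_def by (intro Max_ge) (auto intro: rev_image_eqI)
    have "1 \<le> n" using I unfolding n_def by (intro Max_ge) auto
    then have "\<exists>M. mean_on X M \<and>
       (\<forall>\<phi>\<in>L. \<forall>r\<in>fst ` I. \<forall>c. (\<forall>x\<in>X. \<bar>\<phi> x\<bar> \<le> c) \<longrightarrow> \<bar>M (\<phi> \<circ> r) - M \<phi>\<bar> \<le> 2 * c / real n)"
      using I by (intro almost_invariant_mean X) (auto intro!: maps closed comm[rule_format] simp: subset_iff)
    then obtain M where M: "mean_on X M" and inv: "\<And>\<phi> r c. \<phi> \<in> L \<Longrightarrow> r \<in> fst ` I \<Longrightarrow>
        \<forall>x\<in>X. \<bar>\<phi> x\<bar> \<le> c \<Longrightarrow> \<bar>M (\<phi> \<circ> r) - M \<phi>\<bar> \<le> 2 * c / real n"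
      by blast
    \<comment> \<open>\<open>M\<close> is unconstrained on unbounded functions; it is reset there so as to lie in \<open>K\<close>.\<close>
    define M' where "M' f = (if bounded (f ` X) then M f else 0)" for f
    have M'_eq: "bounded (f ` X) \<Longrightarrow> M' f = M f" for f by (simp add: M'_def)
    have "mean_on X M'"
      using M unfolding mean_on_def
      by (auto simp: M'_eq bounded_plus_comp bounded_scale_image bounded_image_of_bound[of _ _ 1])
    moreover have "M' f \<in> {- B f..B f}" for f
    proof (cases "bounded (f ` X)")
      case True
      then show ?thesis
        using mean_abs_le[OF M le_B[OF True]] by (simp add: M'_eq abs_le_iff minus_le_iff)
    qed (simp add: M'_def B_def)
    then have "M' \<in> K" by (simp add: K_def)
    moreover have "\<bar>M' (\<phi> \<circ> r) - M' \<phi>\<bar> \<le> 2 * c / real m"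
      if "(r, m) \<in> I" "\<phi> \<in> L" and c: "\<forall>x\<in>X. \<bar>\<phi> x\<bar> \<le> c" for r m \<phi> c
    proof -
      have "r \<in> R" "0 < m" using that I by auto
      have "0 \<le> c" using X c by (meson abs_ge_zero all_not_in_conv order_trans)
      have "\<bar>M' (\<phi> \<circ> r) - M' \<phi>\<bar> \<le> 2 * c / real n"
        using inv[OF \<open>\<phi> \<in> L\<close> _ c, of r] \<open>(r, m) \<in> I\<close> \<open>\<phi> \<in> L\<close> \<open>r \<in> R\<close>
        by (simp add: M'_eq bdd closed image_iff del: o_apply) force
      also have "\<dots> \<le> 2 * c / real m"
        using \<open>0 \<le> c\<close> \<open>0 < m\<close> n[OF \<open>(r, m) \<in> I\<close>] by (intro divide_left_mono) auto
      finally show ?thesis .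
    qed
    ultimately have "M' \<in> K \<inter> (\<Inter>i\<in>I. C i)"
      unfolding C_def by auto
    then show "K \<inter> (\<Inter>i\<in>I. C i) \<noteq> {}" by blast
  qed
  then obtain M where MC: "\<And>r n. r \<in> R \<Longrightarrow> 0 < n \<Longrightarrow> M \<in> C (r, n)"
    by auto
  show ?thesis
  proof (cases "R = {}")
    case True
    obtain x where "x \<in> X" using X by blast
    then have "mean_on X (\<lambda>f. f x)" by (auto simp: mean_on_def)
    then show ?thesis using True by blast
  next
    case False
    then obtain r where "r \<in> R" by blast
    then have "mean_on X M" using MC[of r 1] by (simp add: C_def)
    moreover have "M (\<phi> \<circ> r) = M \<phi>" if "\<phi> \<in> L" "r \<in> R" for \<phi> r
    proof -
      have "\<bar>M (\<phi> \<circ> r) - M \<phi>\<bar> \<le> 2 * B \<phi> / real (Suc n)" for n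
        using MC[OF \<open>r \<in> R\<close>, of "Suc n"] that le_B[OF bdd[OF \<open>\<phi> \<in> L\<close>]] by (simp add: C_def del: of_nat_Suc)
      moreover have "(\<lambda>n. 2 * B \<phi> / real (Suc n)) \<longlonglongrightarrow> 0"
        using LIMSEQ_inverse_real_of_nat[THEN tendsto_mult_right_zero] by (simp only: divide_inverse)
      ultimately have "\<bar>M (\<phi> \<circ> r) - M \<phi>\<bar> \<le> 0"
        by (meson LIMSEQ_le_const)
      then show ?thesis by simp
    qed
    ultimately show ?thesis by blast
  qed
qed

section \<open>Right-invariant means and extensions of amenable semigroups\<close>
definition right_invariant_mean ::
    "('a \<Rightarrow> 'a) set \<Rightarrow> ((('a \<Rightarrow> 'a) \<Rightarrow> real) \<Rightarrow> real) \<Rightarrow> bool" where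
  "right_invariant_mean T M \<longleftrightarrow>
     mean_on T M \<and> (\<forall>f. \<forall>s\<in>T. bounded (f ` T) \<longrightarrow> M (\<lambda>t. f (t \<circ> s)) = M f)"

lemma right_amenable_if_mean:
  assumes "right_invariant_mean T M"
  shows "right_amenable (\<circ>) T"
proof -
  have M: "mean_on T M"
    and inv: "bounded (f ` T) \<Longrightarrow> s \<in> T \<Longrightarrow> M (\<lambda>t. f (t \<circ> s)) = M f" for f s
    using assms by (auto simp: right_invariant_mean_def)
  have b: "bounded (indicat_real A ` T)" for A
    by (rule bounded_image_of_bound[of _ _ 1]) simp
  have "0 \<le> M (indicator A)" for A
    by (rule mean_nonneg[OF M b]) simp
  moreover have "M (indicator T) = 1"
    using mean_cong[OF M b, of T "\<lambda>t. 1"] mean_one[OF M] by simp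
  moreover have "M (indicator (A \<union> B)) = M (indicator A) + M (indicator B)"
    if "A \<inter> B = {}" for A B
    using mean_add[OF M b b, of A B] that by (simp add: indicator_add)
  moreover have "M (indicator {g \<in> T. g \<circ> s \<in> A}) = M (indicator A)" if "s \<in> T" for A s
  proof -
    have "M (indicator {g \<in> T. g \<circ> s \<in> A}) = M (\<lambda>t. indicator A (t \<circ> s))"
      by (rule mean_cong[OF M b]) (simp add: indicator_def)
    then show ?thesis using inv[OF b that] by simp
  qed
  ultimately show ?thesis
    unfolding right_amenable_def by (intro exI[of _ "\<lambda>A. M (indicator A)"]) auto
qed

text \<open>The semigroup form of the fact that an extension of an amenable group by an abelian group is
  amenable. The orbits \<open>N t\<close> take the place of the elements of the quotient.\<close>
lemma right_invariant_mean_extension: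
  fixes N T :: "('a \<Rightarrow> 'a) set"
  assumes N: "\<exists>m. right_invariant_mean N m"
    and T: "comp_closed T" "T \<noteq> {}" and "N \<subseteq> T"
    and normal: "\<And>t n. t \<in> T \<Longrightarrow> n \<in> N \<Longrightarrow> \<exists>n'\<in>N. t \<circ> n = n' \<circ> t"
    and comm: "\<And>s t. s \<in> T \<Longrightarrow> t \<in> T \<Longrightarrow> \<exists>n\<in>N. s \<circ> t = n \<circ> (t \<circ> s)"
  shows "\<exists>M. right_invariant_mean T M"
proof -
  obtain m where m: "mean_on N m"
    and m_inv: "\<And>f s. bounded (f ` N) \<Longrightarrow> s \<in> N \<Longrightarrow> m (\<lambda>n. f (n \<circ> s)) = m f"
    using N by (auto simp: right_invariant_mean_def)
  have cl: "s \<circ> t \<in> T" if "s \<in> T" "t \<in> T" for s t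
    using T that by (simp add: comp_closed_def)
  \<comment> \<open>\<open>L\<close> stands for the bounded functions on the quotient of \<open>T\<close> by \<open>N\<close>, and \<open>R\<close> acts on it as a
    commuting family of right translations.\<close>
  define L :: "(('a \<Rightarrow> 'a) \<Rightarrow> real) set"
    where "L = {\<phi>. bounded (\<phi> ` T) \<and> (\<forall>n\<in>N. \<forall>t\<in>T. \<phi> (n \<circ> t) = \<phi> t)}"
  have L_invariant: "\<phi> (n \<circ> t) = \<phi> t" if "\<phi> \<in> L" "n \<in> N" "t \<in> T" for \<phi> n t
    using that by (simp add: L_def)
  define R :: "(('a \<Rightarrow> 'a) \<Rightarrow> ('a \<Rightarrow> 'a)) set" where "R = {\<lambda>t. t \<circ> s |s. s \<in> T}"
  have swap: "\<phi> (u \<circ> b \<circ> a) = \<phi> (u \<circ> a \<circ> b)"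
    if "\<phi> \<in> L" and ab: "a \<in> T" "b \<in> T" and "u \<in> T" for \<phi> a b u
  proof -
    obtain n where n: "n \<in> N" "b \<circ> a = n \<circ> (a \<circ> b)" using comm ab by blast
    obtain n' where n': "n' \<in> N" "u \<circ> n = n' \<circ> u" using normal \<open>u \<in> T\<close> n by blast
    have "u \<circ> b \<circ> a = (u \<circ> n) \<circ> (a \<circ> b)" using n(2) by (simp only: comp_assoc)
    also have "\<dots> = n' \<circ> (u \<circ> a \<circ> b)" by (simp only: n'(2) comp_assoc)
    finally have "\<phi> (u \<circ> b \<circ> a) = \<phi> (n' \<circ> (u \<circ> a \<circ> b))" by (rule arg_cong)
    also have "\<dots> = \<phi> (u \<circ> a \<circ> b)"
      by (rule L_invariant[OF \<open>\<phi> \<in> L\<close> n'(1) cl[OF cl[OF \<open>u \<in> T\<close> ab(1)] ab(2)]])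
    finally show ?thesis .
  qed
  have "\<exists>\<nu>. mean_on T \<nu> \<and> (\<forall>\<phi>\<in>L. \<forall>r\<in>R. \<nu> (\<phi> \<circ> r) = \<nu> \<phi>)"
  proof (rule invariant_mean_exists)
    show "T \<noteq> {}" by fact
    show maps: "r \<in> T \<rightarrow> T" if "r \<in> R" for r
      using that cl by (auto simp: R_def)
    show "bounded (\<phi> ` T)" if "\<phi> \<in> L" for \<phi> using that by (simp add: L_def)
    show "\<phi> \<circ> r \<in> L" if "\<phi> \<in> L" "r \<in> R" for \<phi> r
      using that bounded_image_comp[OF _ maps[OF \<open>r \<in> R\<close>], of \<phi>] cl
      by (auto simp: L_def R_def comp_assoc)
    show "\<forall>\<phi>\<in>L. \<forall>r\<in>R. \<forall>s\<in>R. \<forall>u\<in>T. \<phi> (r (s u)) = \<phi> (s (r u))"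
      unfolding R_def by (auto intro!: swap)
  qed
  then obtain \<nu> where \<nu>: "mean_on T \<nu>"
    and \<nu>_inv: "\<And>\<phi> r. \<phi> \<in> L \<Longrightarrow> r \<in> R \<Longrightarrow> \<nu> (\<phi> \<circ> r) = \<nu> \<phi>" by blast
  \<comment> \<open>The average of \<open>f\<close> along the orbit of \<open>t\<close>. It depends on the orbit only, since passing from
    \<open>t\<close> to \<open>n \<circ> t\<close> is a right translation on \<open>N\<close>, which \<open>m\<close> does not see.\<close>
  define A where "A f t = m (\<lambda>n. f (n \<circ> t))" for f :: "('a \<Rightarrow> 'a) \<Rightarrow> real" and t
  have orbit: "bounded ((\<lambda>n. f (n \<circ> t)) ` N)" if "bounded (f ` T)" "t \<in> T" for f :: "('a \<Rightarrow> 'a) \<Rightarrow> real" and t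
    using that cl \<open>N \<subseteq> T\<close> by (intro bounded_subset[OF that(1)]) auto
  have A_add: "A (\<lambda>t. f t + g t) t = A f t + A g t"
    if "bounded (f ` T)" "bounded (g ` T)" "t \<in> T" for f g t
    unfolding A_def using that by (intro mean_add[OF m] orbit)
  have A_scale: "A (\<lambda>t. c * f t) t = c * A f t" if "bounded (f ` T)" "t \<in> T" for c f t
    unfolding A_def using that by (intro mean_scale[OF m] orbit)
  have A_nonneg: "0 \<le> A f t" if "bounded (f ` T)" "\<And>t. t \<in> T \<Longrightarrow> 0 \<le> f t" "t \<in> T" for f t
    unfolding A_def using that cl \<open>N \<subseteq> T\<close> by (intro mean_nonneg[OF m] orbit) auto
  have A_L: "A f \<in> L" if f: "bounded (f ` T)" for f
  proof -
    obtain c where c: "\<And>t. t \<in> T \<Longrightarrow> \<bar>f t\<bar> \<le> c"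
      using f unfolding bounded_iff by auto
    have "\<bar>A f t\<bar> \<le> c" if "t \<in> T" for t
      unfolding A_def using that cl \<open>N \<subseteq> T\<close> by (intro mean_abs_le[OF m] c) auto
    moreover have "A f (n \<circ> t) = A f t" if "n \<in> N" "t \<in> T" for n t
      using m_inv[OF orbit[OF f \<open>t \<in> T\<close>] \<open>n \<in> N\<close>] by (simp add: A_def comp_assoc)
    ultimately show ?thesis
      by (auto simp: L_def intro: bounded_image_of_bound)
  qed
  then have A_bdd: "bounded (A f ` T)" if "bounded (f ` T)" for f
    using that by (simp add: L_def)
  have b1: "bounded ((\<lambda>t. 1 :: real) ` T)" by (rule bounded_image_of_bound[of _ _ 1]) simp
  have "mean_on T (\<lambda>f. \<nu> (A f))"
    unfolding mean_on_def
  proof (intro conjI allI impI)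
    fix f g :: "('a \<Rightarrow> 'a) \<Rightarrow> real" and c :: real assume f: "bounded (f ` T)"
    show "\<nu> (A (\<lambda>x. c * f x)) = c * \<nu> (A f)"
      using mean_cong[OF \<nu> A_bdd[OF bounded_scale_image[OF f]] A_scale[OF f]]
        mean_scale[OF \<nu> A_bdd[OF f]] by simp
    show "0 \<le> \<nu> (A f)" if "\<forall>x\<in>T. 0 \<le> f x"
      using that by (intro mean_nonneg[OF \<nu>] A_bdd A_nonneg f) auto
    assume g: "bounded (g ` T)"
    show "\<nu> (A (\<lambda>x. f x + g x)) = \<nu> (A f) + \<nu> (A g)"
      using mean_cong[OF \<nu> A_bdd[OF bounded_plus_comp[OF f g]] A_add[OF f g]]
        mean_add[OF \<nu> A_bdd[OF f] A_bdd[OF g]] by simp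
  next
    show "\<nu> (A (\<lambda>x. 1)) = 1"
    proof -
      have "A (\<lambda>x. 1) = (\<lambda>t. 1)" by (simp add: fun_eq_iff A_def mean_one[OF m])
      then show ?thesis by (simp add: mean_one[OF \<nu>])
    qed
  qed
  moreover have "\<nu> (A (\<lambda>t. f (t \<circ> s))) = \<nu> (A f)" if "bounded (f ` T)" "s \<in> T" for f s
  proof -
    have "A (\<lambda>t. f (t \<circ> s)) = A f \<circ> (\<lambda>t. t \<circ> s)"
      by (auto simp: A_def comp_assoc)
    then show ?thesis using \<nu>_inv[OF A_L] that by (auto simp: R_def)
  qed
  ultimately show ?thesis
    unfolding right_invariant_mean_def by (intro exI[of _ "\<lambda>f. \<nu> (A f)"]) auto
qed

section \<open>Subgroups of the affine group\<close>
lemma Aff_subgroup_inverse: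
  assumes "subgroup H Aff_group" "h \<in> H"
  obtains h' where "h' \<in> H" "h \<circ> h' = id" "h' \<circ> h = id"
proof -
  interpret group Aff_group by (rule group_Aff_group)
  have "h \<in> carrier Aff_group" using assms subgroup.subset by blast
  then show ?thesis
    using that[of "inv\<^bsub>Aff_group\<^esub> h"] subgroup.m_inv_closed[OF assms] r_inv l_inv
    by (simp add: Aff_group_def)
qed

lemma Aff_subgroupD:
  assumes "subgroup H Aff_group"
  shows Aff_subgroup_subset: "H \<subseteq> Aff"
    and Aff_subgroup_comp: "h \<in> H \<Longrightarrow> k \<in> H \<Longrightarrow> h \<circ> k \<in> H"
    and Aff_subgroup_id: "id \<in> H"
  using subgroup.subset[OF assms] subgroup.m_closed[OF assms] subgroup.one_closed[OF assms]
  by (auto simp: Aff_group_def)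

lemma Aff_subgroup_cancel:
  assumes H: "subgroup H Aff_group" and "h \<in> H" "n \<circ> h \<in> H"
  shows "n \<in> H"
proof -
  obtain h' where h': "h' \<in> H" "h \<circ> h' = id" by (rule Aff_subgroup_inverse[OF H \<open>h \<in> H\<close>])
  have "n = (n \<circ> h) \<circ> h'" by (simp add: comp_assoc h')
  then show ?thesis using Aff_subgroup_comp[OF H \<open>n \<circ> h \<in> H\<close> \<open>h' \<in> H\<close>] by simp
qed

text \<open>The affine group is metabelian: commutators of affine maps are translations, and translations
  commute. So two extension steps, \<open>{id} \<subseteq> N\<close> and \<open>N \<subseteq> H\<close>, suffice.\<close>
lemma Aff_subgroup_right_invariant_mean:
  assumes H: "subgroup H Aff_group"
  shows "\<exists>M. right_invariant_mean H M"
proof -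
  define N where "N = {h \<in> H. \<exists>b. h = (\<lambda>z. z + b)}"
  note H_comp = Aff_subgroup_comp[OF H]
  have "right_invariant_mean {id} (\<lambda>f. f id)"
    by (simp add: right_invariant_mean_def mean_on_def)
  then have "\<exists>M. right_invariant_mean N M"
  proof (intro right_invariant_mean_extension[of "{id}" N] exI)
    show "comp_closed N"
      using H_comp by (auto simp: comp_closed_def N_def o_def add.assoc)
    have "id = (\<lambda>z::complex. z + 0)" by auto
    then have "id \<in> N" using Aff_subgroup_id[OF H] unfolding N_def by blast
    then show "N \<noteq> {}" "{id} \<subseteq> N" by auto
    show "\<exists>n\<in>{id}. s \<circ> t = n \<circ> (t \<circ> s)" if "s \<in> N" "t \<in> N" for s t
      using that by (auto simp: N_def fun_eq_iff)
  qed auto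
  then show ?thesis
  proof (rule right_invariant_mean_extension)
    show "comp_closed H" using H_comp by (simp add: comp_closed_def)
    show "H \<noteq> {}" using Aff_subgroup_id[OF H] by auto
    show "N \<subseteq> H" by (auto simp: N_def)
    show "\<exists>n'\<in>N. t \<circ> n = n' \<circ> t" if "t \<in> H" "n \<in> N" for t n
    proof -
      obtain a b where t: "t = (\<lambda>z. a * z + b)"
        using subsetD[OF Aff_subgroup_subset[OF H] \<open>t \<in> H\<close>] unfolding Aff_def by blast
      obtain c where n: "n = (\<lambda>z. z + c)" "n \<in> H" using \<open>n \<in> N\<close> by (auto simp: N_def)
      define n' where "n' = (\<lambda>z. z + a * c)"
      have eq: "t \<circ> n = n' \<circ> t" by (simp add: t n n'_def fun_eq_iff algebra_simps)
      then have "n' \<circ> t \<in> H" using H_comp[OF \<open>t \<in> H\<close> \<open>n \<in> H\<close>] by simp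
      then have "n' \<in> H" by (rule Aff_subgroup_cancel[OF H \<open>t \<in> H\<close>])
      then show ?thesis using eq by (auto simp: N_def n'_def)
    qed
    show "\<exists>n\<in>N. s \<circ> t = n \<circ> (t \<circ> s)" if "s \<in> H" "t \<in> H" for s t
    proof -
      obtain a b where s: "s = (\<lambda>z. a * z + b)"
        using subsetD[OF Aff_subgroup_subset[OF H] \<open>s \<in> H\<close>] unfolding Aff_def by blast
      obtain c d where t: "t = (\<lambda>z. c * z + d)"
        using subsetD[OF Aff_subgroup_subset[OF H] \<open>t \<in> H\<close>] unfolding Aff_def by blast
      define n where "n = (\<lambda>z. z + (a * d + b - c * b - d))"
      have eq: "s \<circ> t = n \<circ> (t \<circ> s)" by (simp add: s t n_def fun_eq_iff algebra_simps)
      then have "n \<circ> (t \<circ> s) \<in> H" using H_comp[OF \<open>s \<in> H\<close> \<open>t \<in> H\<close>] by simp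
      then have "n \<in> H" by (rule Aff_subgroup_cancel[OF H H_comp[OF \<open>t \<in> H\<close> \<open>s \<in> H\<close>]])
      then show ?thesis using eq by (auto simp: N_def n_def)
    qed
  qed
qed

section \<open>Nearly abelian semigroups\<close>

text \<open>The maps agree on the range of \<open>h\<close>, which is open, hence everywhere by analytic
  continuation.\<close>
lemma entire_right_cancel:
  fixes f g h :: "complex \<Rightarrow> complex"
  assumes f: "f holomorphic_on UNIV" and g: "g holomorphic_on UNIV" and h: "h holomorphic_on UNIV"
    and "\<not> h constant_on UNIV" and eq: "f \<circ> h = g \<circ> h"
  shows "f = g"
proof
  fix z
  have "open (range h)"
    by (rule open_mapping_thm[OF h]) (use assms in auto)
  then show "f z = g z"
    by (rule analytic_continuation_open[of _ UNIV]) (use f g eq in \<open>auto simp: fun_eq_iff\<close>)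
qed

lemma Aff_holomorphic: "\<gamma> \<in> Aff \<Longrightarrow> \<gamma> holomorphic_on UNIV"
  by (auto simp: Aff_def intro!: holomorphic_intros)

locale nearly_abelian_semigroup =
  fixes S :: "(complex \<Rightarrow> complex) set"
  assumes nearly_abelian: "nearly_abelian S"
begin

abbreviation "G \<equiv> commutator_group S"
abbreviation "T \<equiv> extended_semigroup S"

lemma subgroup_G: "subgroup G Aff_group"
  unfolding commutator_group_def
  by (rule group.generate_is_subgroup[OF group_Aff_group])
     (auto simp: commutator_set_def Aff_group_def)

lemmas G_comp = Aff_subgroup_comp[OF subgroup_G]

lemma G_inverse:
  assumes "\<gamma> \<in> G" obtains \<gamma>' where "\<gamma>' \<in> G" "\<gamma> \<circ> \<gamma>' = id" "\<gamma>' \<circ> \<gamma> = id"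
  by (rule Aff_subgroup_inverse[OF subgroup_G assms])

lemma S_commutator:
  assumes "f \<in> S" "g \<in> S"
  obtains \<gamma> where "\<gamma> \<in> commutator_set S" "\<gamma> \<in> G" "f \<circ> g = \<gamma> \<circ> (g \<circ> f)"
proof -
  obtain \<gamma> where "\<gamma> \<in> Aff" "f \<circ> g = \<gamma> \<circ> g \<circ> f"
    using nearly_abelian assms unfolding nearly_abelian_def by blast
  then have "\<gamma> \<in> commutator_set S" using assms by (auto simp: commutator_set_def)
  then show ?thesis
    using that \<open>f \<circ> g = _\<close> 
    by (auto simp: commutator_group_def comp_assoc intro: generate.incl)
qed

lemma S_entire: "f \<in> S \<Longrightarrow> f holomorphic_on UNIV"
  using nearly_abelian by (auto simp: nearly_abelian_def Ent_def)

lemma S_comp: "f \<in> S \<Longrightarrow> g \<in> S \<Longrightarrow> f \<circ> g \<in> S"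
  using nearly_abelian by (auto simp: nearly_abelian_def comp_closed_def)

text \<open>If \<open>\<gamma>\<close> is the commutator of \<open>f\<close> and \<open>h\<close>, then moving \<open>f\<close> past \<open>g \<circ> h\<close> at once, or past \<open>g\<close>
  first and \<open>h\<close> afterwards, gives two expressions for \<open>f \<circ> g \<circ> h\<close>, both ending in \<open>h \<circ> f\<close>;
  cancelling this map compares \<open>g \<circ> \<gamma>\<close> with \<open>g\<close>.\<close>
lemma S_semiconj_commutator:
  assumes g: "g \<in> S" and \<gamma>: "\<gamma> \<in> commutator_set S"
  shows "\<exists>\<gamma>'\<in>G. g \<circ> \<gamma> = \<gamma>' \<circ> g"
proof -
  obtain f h where fh: "f \<in> S" "h \<in> S" and eq: "f \<circ> h = \<gamma> \<circ> (h \<circ> f)" and "\<gamma> \<in> Aff"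
    using \<gamma> by (auto simp: commutator_set_def comp_assoc)
  obtain \<alpha> where \<alpha>: "\<alpha> \<in> G" "f \<circ> (g \<circ> h) = \<alpha> \<circ> ((g \<circ> h) \<circ> f)"
    using S_commutator[OF \<open>f \<in> S\<close> S_comp[OF g \<open>h \<in> S\<close>]] by metis
  obtain \<beta> where \<beta>: "\<beta> \<in> G" "f \<circ> g = \<beta> \<circ> (g \<circ> f)"
    using S_commutator[OF \<open>f \<in> S\<close> g] by metis
  obtain \<beta>' where \<beta>': "\<beta>' \<in> G" "\<beta>' \<circ> \<beta> = id" by (rule G_inverse[OF \<beta>(1)])
  have Aff: "\<alpha> \<in> Aff" "\<beta> \<in> Aff" using \<alpha> \<beta> Aff_subgroup_subset[OF subgroup_G] by auto
  have "\<beta> \<circ> (g \<circ> \<gamma>) \<circ> (h \<circ> f) = \<beta> \<circ> g \<circ> (f \<circ> h)"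
    by (simp add: comp_assoc eq)
  also have "\<dots> = (f \<circ> g) \<circ> h" by (simp add: comp_assoc \<beta>(2))
  also have "\<dots> = (\<alpha> \<circ> g) \<circ> (h \<circ> f)" using \<alpha>(2) by (simp add: comp_assoc)
  finally have "\<beta> \<circ> (g \<circ> \<gamma>) \<circ> (h \<circ> f) = (\<alpha> \<circ> g) \<circ> (h \<circ> f)" .
  then have "\<beta> \<circ> (g \<circ> \<gamma>) = \<alpha> \<circ> g"
  proof (rule entire_right_cancel[rotated -1])
    show "\<beta> \<circ> (g \<circ> \<gamma>) holomorphic_on UNIV" "\<alpha> \<circ> g holomorphic_on UNIV"
      using Aff \<open>\<gamma> \<in> Aff\<close> S_entire[OF g] Aff_holomorphic
      by (auto intro!: holomorphic_on_compose intro: holomorphic_on_subset)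
    show "h \<circ> f holomorphic_on UNIV" using S_entire S_comp fh by blast
    show "\<not> (h \<circ> f) constant_on UNIV"
      using nearly_abelian S_comp fh by (simp add: nearly_abelian_def)
  qed
  then have "\<beta>' \<circ> \<beta> \<circ> (g \<circ> \<gamma>) = (\<beta>' \<circ> \<alpha>) \<circ> g" by (simp add: comp_assoc)
  then have "g \<circ> \<gamma> = (\<beta>' \<circ> \<alpha>) \<circ> g" by (simp add: \<beta>')
  then show ?thesis using G_comp[OF \<beta>'(1) \<alpha>(1)] by blast
qed

lemma S_semiconj_G:
  assumes g: "g \<in> S" and "\<gamma> \<in> G"
  shows "\<exists>\<gamma>'\<in>G. g \<circ> \<gamma> = \<gamma>' \<circ> g"
  using \<open>\<gamma> \<in> G\<close>[unfolded commutator_group_def]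
proof (induction rule: generate.induct)
  case one
  then show ?case
    using Aff_subgroup_id[OF subgroup_G] by (auto simp: Aff_group_def intro!: bexI[of _ id])
next
  case (incl \<gamma>)
  then show ?case by (rule S_semiconj_commutator[OF g])
next
  case (inv \<gamma>)
  interpret group Aff_group by (rule group_Aff_group)
  have "\<gamma> \<in> carrier Aff_group" using inv by (simp add: commutator_set_def Aff_group_def)
  then have \<delta>: "\<gamma> \<circ> inv\<^bsub>Aff_group\<^esub> \<gamma> = id"
    using r_inv by (simp add: Aff_group_def)
  obtain \<gamma>' where \<gamma>': "\<gamma>' \<in> G" "g \<circ> \<gamma> = \<gamma>' \<circ> g" using S_semiconj_commutator[OF g inv] by blast
  obtain \<gamma>'' where \<gamma>'': "\<gamma>'' \<in> G" "\<gamma>'' \<circ> \<gamma>' = id" by (rule G_inverse[OF \<gamma>'(1)])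
  have "g \<circ> inv\<^bsub>Aff_group\<^esub> \<gamma> = (\<gamma>'' \<circ> \<gamma>') \<circ> g \<circ> inv\<^bsub>Aff_group\<^esub> \<gamma>" by (simp add: \<gamma>'')
  also have "\<dots> = \<gamma>'' \<circ> g \<circ> (\<gamma> \<circ> inv\<^bsub>Aff_group\<^esub> \<gamma>)"
    by (simp only: comp_assoc flip: \<gamma>'(2))
  also have "\<dots> = \<gamma>'' \<circ> g" by (simp add: \<delta>)
  finally show ?case using \<gamma>'' by blast
next
  case (eng \<gamma> \<delta>)
  then obtain \<gamma>' \<delta>' where *: "\<gamma>' \<in> G" "g \<circ> \<gamma> = \<gamma>' \<circ> g" "\<delta>' \<in> G" "g \<circ> \<delta> = \<delta>' \<circ> g" by blast
  have "g \<circ> (\<gamma> \<circ> \<delta>) = (g \<circ> \<gamma>) \<circ> \<delta>" by (simp only: comp_assoc)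
  also have "\<dots> = (\<gamma>' \<circ> \<delta>') \<circ> g" by (simp only: *(2,4) comp_assoc)
  finally show ?case
    using G_comp[OF *(1,3)] by (auto simp: Aff_group_def simp del: o_apply)
qed

lemma T_induct [consumes 1, case_names G S comp]:
  assumes "t \<in> T"
    and "\<And>\<gamma>. \<gamma> \<in> G \<Longrightarrow> P \<gamma>" "\<And>f. f \<in> S \<Longrightarrow> P f"
    and "\<And>s t. s \<in> T \<Longrightarrow> t \<in> T \<Longrightarrow> P s \<Longrightarrow> P t \<Longrightarrow> P (s \<circ> t)"
  shows "P t"
  using assms(1)[unfolded extended_semigroup_def]
  by (induction rule: comp_semigroup_generated.induct)
     (use assms(2-) in \<open>auto simp: extended_semigroup_def simp del: o_apply\<close>)

lemma G_subset_T: "G \<subseteq> T"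
  by (auto simp: extended_semigroup_def intro: comp_semigroup_generated.base)

lemma T_semiconj_G:
  assumes "t \<in> T" "\<gamma> \<in> G"
  shows "\<exists>\<gamma>'\<in>G. t \<circ> \<gamma> = \<gamma>' \<circ> t"
  using assms
proof (induction arbitrary: \<gamma> rule: T_induct)
  case (G g)
  obtain g' where g': "g' \<in> G" "g' \<circ> g = id" by (rule G_inverse[OF \<open>g \<in> G\<close>])
  have "g \<circ> \<gamma> = (g \<circ> \<gamma> \<circ> g') \<circ> g" by (simp add: comp_assoc g')
  then show ?case using G_comp G g' by blast
next
  case (S f)
  then show ?case by (rule S_semiconj_G)
next
  case (comp s t)
  obtain \<delta> where \<delta>: "\<delta> \<in> G" "t \<circ> \<gamma> = \<delta> \<circ> t" using comp by blast
  obtain \<epsilon> where \<epsilon>: "\<epsilon> \<in> G" "s \<circ> \<delta> = \<epsilon> \<circ> s" using comp \<delta> by blast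
  have "(s \<circ> t) \<circ> \<gamma> = (s \<circ> \<delta>) \<circ> t" by (simp only: comp_assoc \<delta>(2))
  also have "\<dots> = \<epsilon> \<circ> (s \<circ> t)" by (simp only: comp_assoc \<epsilon>(2))
  finally show ?case using \<epsilon> by blast
qed

text \<open>The commutation relation on \<open>S\<close> is extended to \<open>T\<close> by induction on generation in each
  argument: the relation is symmetric because \<open>G\<close> is a group, and it passes to products because
  elements of \<open>G\<close> can be moved to the left past any element of \<open>T\<close>.\<close>
definition commute_mod_G :: "(complex \<Rightarrow> complex) \<Rightarrow> (complex \<Rightarrow> complex) \<Rightarrow> bool" where
  "commute_mod_G s t \<longleftrightarrow> (\<exists>\<gamma>\<in>G. s \<circ> t = \<gamma> \<circ> (t \<circ> s))"

lemma commute_mod_G_sym: "commute_mod_G s t \<Longrightarrow> commute_mod_G t s"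
proof -
  assume "commute_mod_G s t"
  then obtain \<gamma> where \<gamma>: "\<gamma> \<in> G" "s \<circ> t = \<gamma> \<circ> (t \<circ> s)" by (auto simp: commute_mod_G_def)
  obtain \<gamma>' where \<gamma>': "\<gamma>' \<in> G" "\<gamma>' \<circ> \<gamma> = id" by (rule G_inverse[OF \<gamma>(1)])
  have "t \<circ> s = (\<gamma>' \<circ> \<gamma>) \<circ> (t \<circ> s)" by (simp add: \<gamma>')
  also have "\<dots> = \<gamma>' \<circ> (s \<circ> t)" by (simp only: comp_assoc \<gamma>(2))
  finally show ?thesis using \<gamma>' by (auto simp: commute_mod_G_def)
qed

lemma commute_mod_G_right:
  assumes "\<gamma> \<in> G" "t \<in> T"
  shows "commute_mod_G t \<gamma>"
proof -
  obtain \<delta> where \<delta>: "\<delta> \<in> G" "t \<circ> \<gamma> = \<delta> \<circ> t" using T_semiconj_G assms by blast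
  obtain \<gamma>' where \<gamma>': "\<gamma>' \<in> G" "\<gamma>' \<circ> \<gamma> = id" by (rule G_inverse[OF \<open>\<gamma> \<in> G\<close>])
  have "t \<circ> \<gamma> = \<delta> \<circ> (\<gamma>' \<circ> \<gamma>) \<circ> t" by (simp add: \<delta> \<gamma>')
  also have "\<dots> = (\<delta> \<circ> \<gamma>') \<circ> (\<gamma> \<circ> t)" by (simp only: comp_assoc)
  finally show ?thesis using G_comp[OF \<delta>(1) \<gamma>'(1)] by (auto simp: commute_mod_G_def)
qed

lemma commute_mod_G_comp:
  assumes "commute_mod_G s u" "commute_mod_G t u" "s \<in> T"
  shows "commute_mod_G (s \<circ> t) u"
proof -
  obtain \<gamma> \<delta> where *: "\<gamma> \<in> G" "s \<circ> u = \<gamma> \<circ> (u \<circ> s)" "\<delta> \<in> G" "t \<circ> u = \<delta> \<circ> (u \<circ> t)"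
    using assms by (auto simp: commute_mod_G_def)
  obtain \<epsilon> where \<epsilon>: "\<epsilon> \<in> G" "s \<circ> \<delta> = \<epsilon> \<circ> s" using T_semiconj_G[OF \<open>s \<in> T\<close> *(3)] by blast
  have "(s \<circ> t) \<circ> u = (s \<circ> \<delta>) \<circ> (u \<circ> t)" by (simp only: comp_assoc *(4))
  also have "\<dots> = \<epsilon> \<circ> (s \<circ> u) \<circ> t" by (simp only: comp_assoc \<epsilon>(2))
  also have "\<dots> = (\<epsilon> \<circ> \<gamma>) \<circ> (u \<circ> (s \<circ> t))" by (simp only: comp_assoc *(2))
  finally show ?thesis using G_comp[OF \<epsilon>(1) *(1)] by (auto simp: commute_mod_G_def)
qed

lemma T_commute_mod_G:
  assumes "s \<in> T" "t \<in> T"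
  shows "commute_mod_G s t"
  using assms
proof (induction arbitrary: t rule: T_induct)
  case (G \<gamma>)
  then show ?case by (intro commute_mod_G_sym[OF commute_mod_G_right])
next
  case (S f)
  have "f \<in> T"
    using S(1) by (auto simp: extended_semigroup_def intro: comp_semigroup_generated.base)
  show ?case
    using \<open>t \<in> T\<close>
  proof (induction rule: T_induct)
    case (G \<gamma>)
    then show ?case using commute_mod_G_right \<open>f \<in> T\<close> by blast
  next
    case (S g)
    then show ?case using S_commutator[OF \<open>f \<in> S\<close>, of g] by (metis commute_mod_G_def)
  next
    case (comp s t)
    then show ?case by (meson commute_mod_G_comp commute_mod_G_sym)
  qed
next
  case (comp s t u)
  then show ?case by (intro commute_mod_G_comp)
qed

lemma T_right_invariant_mean: "\<exists>M. right_invariant_mean T M"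
proof (rule right_invariant_mean_extension)
  show "\<exists>m. right_invariant_mean G m"
    by (rule Aff_subgroup_right_invariant_mean[OF subgroup_G])
  show "comp_closed T"
    by (auto simp: comp_closed_def extended_semigroup_def intro: comp_semigroup_generated.comp)
  show "G \<subseteq> T" by (rule G_subset_T)
  then show "T \<noteq> {}" using Aff_subgroup_id[OF subgroup_G] by blast
  show "\<exists>n'\<in>G. t \<circ> n = n' \<circ> t" if "t \<in> T" "n \<in> G" for t n
    using that by (rule T_semiconj_G)
  show "\<exists>n\<in>G. s \<circ> t = n \<circ> (t \<circ> s)" if "s \<in> T" "t \<in> T" for s t
    using T_commute_mod_G[OF that] by (simp add: commute_mod_G_def)
qed

end

theorem theorem15:
  fixes S :: "(complex \<Rightarrow> complex) set"
  assumes "nearly_abelian S"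
  shows "right_amenable (\<circ>) (extended_semigroup S)"
proof -
  interpret nearly_abelian_semigroup S by unfold_locales fact
  show ?thesis using T_right_invariant_mean right_amenable_if_mean by blast
qed

end
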